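(* For $G=\mathbb{Z}_9$ there are three types of group games: the $16$ game subsets of $\mathbb{Z}_9$ are divided into three types as follows, and the games of different types are not isomorphic while those of the same type are isomorphic. TYPE I ($A=\{1,3,5,7\}$ or $A=[1,4]=\{1,2,3,4\}$): the game $\Gamma[A]$ is reducible, with $Aut(\Gamma[A])=\mathbb{Z}_9$. The six Type I game subsets $B$ such that $\Gamma[B]$ is isomorphic to $\Gamma[A]$ are the elements of $\{m_a(A):a\in\mathbb{Z}_9^*\}$. TYPE II ($A=\{1,5,6,7\}$): the game $\Gamma[A]$ is not reducible, but has $Aut(\Gamma[A])=\mathbb{Z}_9$. The six Type II game subsets $B$ such that $\Gamma[B]$ is isomorphic to $\Gamma[A]$ are the elements of $\{m_a(A):a\in\mathbb{Z}_9^*\}$. TYPE III ($A_1=\{1,3,4,7\}$, $A_2=\{1,4,6,7\}$): there is a non-affine isomorphism between $\Gamma[A_1]$ and $\Gamma[A_2]$. The Type III games are isomorphic to the lexicographic product $\Gamma_3\ltimes\Gamma_3$ with automorphism group the semi-direct product $\mathbb{Z}_3\ltimes(\mathbb{Z}_3)^3$. The four Type III game subsets are $A_1,-A_1,A_2,-A_2$.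
   Context: A game subset of $\mathbb{Z}_9$ (additive group of integers mod $9$) is $A\subset\mathbb{Z}_9$ with $\mathbb{Z}_9$ the disjoint union $A\cup(-A)\cup\{0\}$; there are $2^4=16$ of them. The group game is $\Gamma[A]=\{(i,j):j-i\in A\}$, a regular tournament. $\mathbb{Z}_9^*$ is the group of units of the ring $\mathbb{Z}_9$ and $m_a(i)=ai$. Isomorphisms are bijections of vertices preserving edges in both directions; $Aut(\Gamma[A])=\mathbb{Z}_9$ means that the translations $i\mapsto i+k$ are the only automorphisms. A map of $\mathbb{Z}_9$ is affine if it has the form $i\mapsto ai+k$ with $a\in\mathbb{Z}_9^*$, $k\in\mathbb{Z}_9$. A game (tournament on $2n+1$ vertices with all in- and out-degrees $n$) on $I$ is reducible if for some pair of distinct vertices $u,v$ the restriction to $I\setminus\{u,v\}$ is a game. $\Gamma_3=\{(0,1),(1,2),(2,0)\}$ is the $3$-cycle on $\mathbb{Z}_3$. The lexicographic product $\Gamma\ltimes\Pi$ of digraphs on $I$ and $J$ is the digraph on $I\times J$ with $(p_1,p_2)\to(q_1,q_2)$ iff $p_1\to q_1$ in $\Gamma$, or $p_1=q_1$ and $p_2\to q_2$ in $\Pi$. $\mathbb{Z}_3\ltimes(\mathbb{Z}_3)^3$ is the semi-direct product in which $\mathbb{Z}_3$ acts on $(\mathbb{Z}_3)^3=$ maps $\mathbb{Z}_3\to\mathbb{Z}_3$ by translating the index (the wreath product). *)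

theory Defs
  imports
    "HOL-Library.Numeral_Type"
    "HOL-Library.Disjoint_Sets"
    "HOL-Algebra.Bij"
    "HOL-Algebra.Product_Groups"
begin

text \<open>
  A digraph is a vertex set \<open>I\<close> together with an edge relation \<open>E \<subseteq> I \<times> I\<close>.
  The rings of integers mod \<open>9\<close> and mod \<open>3\<close> are the types \<open>9\<close> and \<open>3\<close> of
  \<^theory>\<open>HOL-Library.Numeral_Type\<close>, whose arithmetic is modular.
\<close>

definition tournament_on :: "'a set \<Rightarrow> 'a rel \<Rightarrow> bool" where
  "tournament_on I E \<longleftrightarrow>
     E \<subseteq> I \<times> I \<and> irrefl E \<and>
     (\<forall>i\<in>I. \<forall>j\<in>I. i \<noteq> j \<longrightarrow> ((i, j) \<in> E \<longleftrightarrow> (j, i) \<notin> E))"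

definition game_on :: "'a set \<Rightarrow> 'a rel \<Rightarrow> bool" where
  "game_on I E \<longleftrightarrow>
     finite I \<and> tournament_on I E \<and>
     (\<exists>n. card I = 2 * n + 1 \<and>
          (\<forall>i\<in>I. card {j \<in> I. (i, j) \<in> E} = n \<and> card {j \<in> I. (j, i) \<in> E} = n))"

definition digraph_restrict :: "'a rel \<Rightarrow> 'a set \<Rightarrow> 'a rel" where
  "digraph_restrict E J = E \<inter> J \<times> J"

text \<open>Only meant to be applied when \<open>E\<close> is a game on \<open>I\<close>.\<close>

definition reducible_game :: "'a set \<Rightarrow> 'a rel \<Rightarrow> bool" where
  "reducible_game I E \<longleftrightarrow>
     (\<exists>u\<in>I. \<exists>v\<in>I. u \<noteq> v \<and> game_on (I - {u, v}) (digraph_restrict E (I - {u, v})))"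

definition digraph_iso :: "'a set \<Rightarrow> 'a rel \<Rightarrow> 'b set \<Rightarrow> 'b rel \<Rightarrow> ('a \<Rightarrow> 'b) \<Rightarrow> bool" where
  "digraph_iso I E J F f \<longleftrightarrow>
     bij_betw f I J \<and> (\<forall>x\<in>I. \<forall>y\<in>I. (x, y) \<in> E \<longleftrightarrow> (f x, f y) \<in> F)"

definition digraph_isomorphic :: "'a set \<Rightarrow> 'a rel \<Rightarrow> 'b set \<Rightarrow> 'b rel \<Rightarrow> bool" where
  "digraph_isomorphic I E J F \<longleftrightarrow> (\<exists>f. digraph_iso I E J F f)"

definition digraph_Aut :: "'a set \<Rightarrow> 'a rel \<Rightarrow> ('a \<Rightarrow> 'a) monoid" where
  "digraph_Aut I E = (BijGroup I)\<lparr>carrier := {f \<in> Bij I. digraph_iso I E I E f}\<rparr>"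

definition game_subset :: "'a::ab_group_add set \<Rightarrow> bool" where
  "game_subset A \<longleftrightarrow>
     A \<inter> uminus ` A = {} \<and> 0 \<notin> A \<and> 0 \<notin> uminus ` A \<and> A \<union> uminus ` A \<union> {0} = UNIV"

definition group_game :: "'a::ab_group_add set \<Rightarrow> 'a rel" (\<open>\<Gamma>[_]\<close>) where
  "\<Gamma>[A] = {(i, j). j - i \<in> A}"

definition translation_maps :: "('a::ab_group_add \<Rightarrow> 'a) set" where
  "translation_maps = range (\<lambda>k i. i + k)"

definition affine_map :: "('a::comm_ring_1 \<Rightarrow> 'a) \<Rightarrow> bool" where
  "affine_map f \<longleftrightarrow> (\<exists>a k. a dvd 1 \<and> f = (\<lambda>i. a * i + k))"

definition unit_multiples :: "'a::comm_ring_1 set \<Rightarrow> 'a set set" where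
  "unit_multiples A = {(*) a ` A | a. a dvd 1}"

definition typeI :: "9 set set" where
  "typeI = unit_multiples {1, 3, 5, 7}"

definition typeII :: "9 set set" where
  "typeII = unit_multiples {1, 5, 6, 7}"

definition typeIII :: "9 set set" where
  "typeIII = {{1, 3, 4, 7}, uminus ` {1, 3, 4, 7}, {1, 4, 6, 7}, uminus ` {1, 4, 6, 7}}"

text \<open>
  The lexicographic product of digraphs is the library's \<open><*lex*>\<close>.
\<close>

definition \<Gamma>3 :: "3 rel" where
  "\<Gamma>3 = {(0, 1), (1, 2), (2, 0)}"

definition semidirect_product ::
    "'g monoid \<Rightarrow> ('g \<Rightarrow> 'n \<Rightarrow> 'n) \<Rightarrow> 'n monoid \<Rightarrow> ('g \<times> 'n) monoid" where
  "semidirect_product G \<phi> N =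
     \<lparr>carrier = carrier G \<times> carrier N,
      mult = (\<lambda>(g, n) (h, m). (g \<otimes>\<^bsub>G\<^esub> h, n \<otimes>\<^bsub>N\<^esub> \<phi> g m)),
      one = (\<one>\<^bsub>G\<^esub>, \<one>\<^bsub>N\<^esub>)\<rparr>"

definition Z3 :: "3 monoid" where
  "Z3 = \<lparr>carrier = UNIV, mult = (+), one = 0\<rparr>"

definition Z3_wreath_Z3 :: "(3 \<times> (3 \<Rightarrow> 3)) monoid" where
  "Z3_wreath_Z3 =
     semidirect_product Z3 (\<lambda>a f i. f (i - a)) (product_group UNIV (\<lambda>_. Z3))"

end

theory Submission
  imports Defs
begin

text \<open>
  The three types are told apart by the numbers of common out-neighbours of the two ends of an edge:
  these take the values \<open>{0, 1, 2, 3}\<close> for Type I, \<open>{1, 2}\<close> for Type II and \<open>{1, 3}\<close> for Type III.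
  For Types I and II the same counts along the edges leaving \<open>0\<close> (for Type II, together with the
  directions of two further edges) show that the stabiliser of \<open>0\<close> is trivial, so that all automorphisms are translations. In \<open>\<Gamma>3 <*lex*> \<Gamma>3\<close> the count singles out
  the edges inside a block, so automorphisms permute the three blocks cyclically and rotate each of
  them independently, which gives the wreath product. Finally, deleting \<open>u\<close> and \<open>v\<close> from a group game
  leaves a game iff \<open>x \<mapsto> (u - v) - x\<close> preserves \<open>A\<close> away from \<open>0\<close> and \<open>u - v\<close>.
\<close>

subsection \<open>Isomorphisms of digraphs\<close>

lemma digraph_iso_comp:
  assumes "digraph_iso I E J F f" "digraph_iso J F K G g"
  shows "digraph_iso I E K G (g \<circ> f)"
  using assms bij_betw_trans[of f I J g K] bij_betwE[of f I J] unfolding digraph_iso_def by simp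

lemma digraph_iso_inv_into:
  assumes "digraph_iso I E J F f"
  shows "digraph_iso J F I E (inv_into I f)"
proof -
  have b: "bij_betw f I J" using assms by (simp add: digraph_iso_def)
  then have "bij_betw (inv_into I f) J I" by (rule bij_betw_inv_into)
  with b assms show ?thesis
    using bij_betwE[of "inv_into I f" J I] bij_betw_inv_into_right[OF b]
    unfolding digraph_iso_def by simp
qed

lemma digraph_isomorphic_sym: "digraph_isomorphic I E J F \<Longrightarrow> digraph_isomorphic J F I E"
  unfolding digraph_isomorphic_def using digraph_iso_inv_into by blast

lemma digraph_isomorphic_trans:
  "digraph_isomorphic I E J F \<Longrightarrow> digraph_isomorphic J F K G \<Longrightarrow> digraph_isomorphic I E K G"
  unfolding digraph_isomorphic_def using digraph_iso_comp by blast

section \<open>Common out-neighbour counts as an isomorphism invariant\<close>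

definition common_out :: "'a set \<Rightarrow> 'a rel \<Rightarrow> 'a \<Rightarrow> 'a \<Rightarrow> nat" where
  "common_out I E x y = card {z \<in> I. (x, z) \<in> E \<and> (y, z) \<in> E}"

text \<open>A set of values without multiplicities: this already separates the three types.\<close>

definition out_profile :: "'a set \<Rightarrow> 'a rel \<Rightarrow> nat set" where
  "out_profile I E = {common_out I E x y | x y. x \<in> I \<and> y \<in> I \<and> (x, y) \<in> E}"

lemma common_out_iso:
  assumes "digraph_iso I E J F f" "x \<in> I" "y \<in> I"
  shows "common_out J F (f x) (f y) = common_out I E x y"
proof -
  have b: "bij_betw f I J" and e: "\<And>x y. x \<in> I \<Longrightarrow> y \<in> I \<Longrightarrow> (x, y) \<in> E \<longleftrightarrow> (f x, f y) \<in> F"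
    using assms(1) by (auto simp: digraph_iso_def)
  have "f ` {z \<in> I. (x, z) \<in> E \<and> (y, z) \<in> E} = {z \<in> J. (f x, z) \<in> F \<and> (f y, z) \<in> F}"
    unfolding bij_betw_imp_surj_on[OF b, symmetric] using e assms(2,3) by blast
  moreover have "inj_on f {z \<in> I. (x, z) \<in> E \<and> (y, z) \<in> E}"
    using bij_betw_imp_inj_on[OF b] by (rule inj_on_subset) blast
  then have "card (f ` {z \<in> I. (x, z) \<in> E \<and> (y, z) \<in> E}) = common_out I E x y"
    unfolding common_out_def by (rule card_image)
  ultimately show ?thesis
    by (simp add: common_out_def)
qed

lemma out_profile_iso_subset:
  assumes "digraph_iso I E J F f"
  shows "out_profile I E \<subseteq> out_profile J F"
proof
  fix n assume "n \<in> out_profile I E"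
  then obtain x y where "x \<in> I" "y \<in> I" "(x, y) \<in> E" "n = common_out I E x y"
    unfolding out_profile_def by blast
  then have "f x \<in> J" "f y \<in> J" "(f x, f y) \<in> F" "n = common_out J F (f x) (f y)"
    using assms common_out_iso[OF assms] by (auto simp: digraph_iso_def bij_betw_def)
  then show "n \<in> out_profile J F"
    unfolding out_profile_def by blast
qed

lemma out_profile_isomorphic:
  assumes "digraph_isomorphic I E J F"
  shows "out_profile I E = out_profile J F"
proof (rule subset_antisym)
  show "out_profile I E \<subseteq> out_profile J F"
    using assms out_profile_iso_subset unfolding digraph_isomorphic_def by blast
  show "out_profile J F \<subseteq> out_profile I E"
    using digraph_isomorphic_sym[OF assms] out_profile_iso_subset
    unfolding digraph_isomorphic_def by blast
qed

section \<open>Deleting two vertices from a game\<close>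

text \<open>Both degrees have to drop from n to n - 1, so each remaining w must beat exactly one of
  u and v. In a tournament this says that w beats u iff v beats w.\<close>

lemma game_on_remove_two_iff:
  assumes E: "game_on I E" and uv: "u \<in> I" "v \<in> I" "u \<noteq> v"
  shows "game_on (I - {u, v}) (digraph_restrict E (I - {u, v})) \<longleftrightarrow>
    (\<forall>w\<in>I - {u, v}. (w, u) \<in> E \<longleftrightarrow> (v, w) \<in> E)"
proof -
  let ?J = "I - {u, v}"
  let ?F = "digraph_restrict E ?J"
  have fin: "finite I" and t: "tournament_on I E" using E by (auto simp: game_on_def)
  obtain n where n: "card I = 2 * n + 1"
    and deg: "\<And>i. i \<in> I \<Longrightarrow> card {j \<in> I. (i, j) \<in> E} = n \<and> card {j \<in> I. (j, i) \<in> E} = n"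
    using E by (auto simp: game_on_def)
  \<comment> \<open>Each degree splits into the part inside \<open>?J\<close> and the contribution
    of u and v.\<close>
  have split: "card {j \<in> I. P j} =
      card {j \<in> ?J. P j} + ((if P u then 1 else 0) + (if P v then 1 else 0))" for P
  proof -
    have "{j \<in> I. P j} = {j \<in> ?J. P j} \<union> {j \<in> {u, v}. P j}" using uv by auto
    also have "card \<dots> = card {j \<in> ?J. P j} + card {j \<in> {u, v}. P j}"
      using fin by (intro card_Un_disjoint) auto
    also have "{j \<in> {u, v}. P j} = (if P u then {u} else {}) \<union> (if P v then {v} else {})"
      by auto
    also have "card \<dots> = (if P u then 1 else 0) + (if P v then 1 else 0)"
      using uv(3) by simp
    finally show ?thesis .
  qed
  \<comment> \<open>The bound on n keeps the natural subtraction n - 1 from truncating.\<close>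
  have card_J: "card ?J = 2 * (n - 1) + 1" and n_pos: "n \<ge> 1"
  proof -
    have "card {u, v} \<le> card I" using fin uv by (intro card_mono) auto
    then show "n \<ge> 1" using n uv(3) by simp
    then show "card ?J = 2 * (n - 1) + 1"
      using fin uv n by (simp add: card_Diff_subset)
  qed
  have tJ: "tournament_on ?J ?F"
    using t unfolding tournament_on_def digraph_restrict_def irrefl_def by blast
  have F: "{j \<in> ?J. (w, j) \<in> ?F} = {j \<in> ?J. (w, j) \<in> E}"
    "{j \<in> ?J. (j, w) \<in> ?F} = {j \<in> ?J. (j, w) \<in> E}" if "w \<in> ?J" for w
    using that by (auto simp: digraph_restrict_def)
  have "card {j \<in> ?J. (w, j) \<in> ?F} = n - 1 \<and> card {j \<in> ?J. (j, w) \<in> ?F} = n - 1 \<longleftrightarrow>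
      ((w, u) \<in> E \<longleftrightarrow> (v, w) \<in> E)" if w: "w \<in> ?J" for w
  proof -
    have "(w, u) \<in> E \<longleftrightarrow> (u, w) \<notin> E" "(w, v) \<in> E \<longleftrightarrow> (v, w) \<notin> E"
      using t w uv unfolding tournament_on_def by auto
    then show ?thesis
      using split[of "\<lambda>j. (w, j) \<in> E"] split[of "\<lambda>j. (j, w) \<in> E"] deg[of w] w n_pos
      unfolding F[OF w] by (auto split: if_splits)
  qed
  then show ?thesis
    unfolding game_on_def using fin tJ card_J by auto
qed

section \<open>Automorphism groups under composition and conjugation\<close>

text \<open>\<open>Bij\<close> asks for extensional functions, a vacuous demand over
  \<open>UNIV\<close>.\<close>

lemma carrier_digraph_Aut_UNIV: "carrier (digraph_Aut UNIV E) = {f. digraph_iso UNIV E UNIV E f}"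
  by (auto simp: digraph_Aut_def Bij_def digraph_iso_def)

text \<open>The product of \<open>BijGroup\<close> is \<open>compose\<close> restricted to
  bijections, so it is plain composition only on such arguments.\<close>

lemma mult_digraph_Aut_UNIV:
  assumes "digraph_iso UNIV E UNIV E f" "digraph_iso UNIV E UNIV E g"
  shows "f \<otimes>\<^bsub>digraph_Aut UNIV E\<^esub> g = f \<circ> g"
  using assms
  by (auto simp: digraph_Aut_def BijGroup_def Bij_def digraph_iso_def compose_def)

text \<open>Carries the automorphism group of the lexicographic product over to the Type III games.
  The inverse is conjugation by the inverse of f.\<close>

lemma digraph_Aut_conjugation:
  assumes "digraph_iso UNIV E UNIV F f"
  shows "(\<lambda>g. f \<circ> g \<circ> inv_into UNIV f) \<in> iso (digraph_Aut UNIV E) (digraph_Aut UNIV F)"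
proof -
  have bij: "bij f" using assms by (simp add: digraph_iso_def)
  have f': "digraph_iso UNIV F UNIV E (inv_into UNIV f)"
    by (rule digraph_iso_inv_into[OF assms])
  let ?\<phi> = "\<lambda>g. f \<circ> g \<circ> inv_into UNIV f"
  have \<phi>: "digraph_iso UNIV F UNIV F (?\<phi> g)" if "digraph_iso UNIV E UNIV E g" for g
    by (intro digraph_iso_comp[OF f'] digraph_iso_comp[OF that assms])
  have \<psi>: "digraph_iso UNIV E UNIV E (inv_into UNIV f \<circ> h \<circ> f)" if "digraph_iso UNIV F UNIV F h" for h
    by (intro digraph_iso_comp[OF assms] digraph_iso_comp[OF that f'])
  have cancel: "inv_into UNIV f (f x) = x" "f (inv_into UNIV f y) = y" for x y
    by (simp_all add: bij_betw_inv_into_left[OF bij] bij_betw_inv_into_right[OF bij])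
  have "?\<phi> \<in> hom (digraph_Aut UNIV E) (digraph_Aut UNIV F)"
    by (rule homI) (simp_all add: carrier_digraph_Aut_UNIV \<phi> mult_digraph_Aut_UNIV fun_eq_iff cancel)
  moreover have "bij_betw ?\<phi> {g. digraph_iso UNIV E UNIV E g} {h. digraph_iso UNIV F UNIV F h}"
    by (rule bij_betw_byWitness[where f' = "\<lambda>h. inv_into UNIV f \<circ> h \<circ> f"])
      (auto simp: \<phi> \<psi> fun_eq_iff cancel)
  ultimately show ?thesis
    by (simp add: iso_def carrier_digraph_Aut_UNIV)
qed

subsection \<open>Group games\<close>

lemma game_subset_iff:
  "game_subset A \<longleftrightarrow> 0 \<notin> A \<and> (\<forall>x. x \<noteq> 0 \<longrightarrow> (x \<in> A \<longleftrightarrow> - x \<notin> A))"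
proof -
  have "x \<in> uminus ` A \<longleftrightarrow> - x \<in> A" for x :: 'a
    by (metis image_iff minus_minus)
  then show ?thesis
    unfolding game_subset_def disjoint_iff set_eq_iff by (auto; metis minus_zero)
qed

lemma group_game_iff [simp]: "(x, y) \<in> \<Gamma>[A] \<longleftrightarrow> y - x \<in> A"
  by (simp add: group_game_def)

text \<open>Write a common out-neighbour as z = x + a; then z - y = a - (y - x), so only the
  difference y - x matters.\<close>

lemma common_out_group_game:
  fixes A :: "'a::ab_group_add set"
  shows "common_out UNIV \<Gamma>[A] x y = card {a \<in> A. a - (y - x) \<in> A}"
proof -
  have "(+) x ` {a \<in> A. a - (y - x) \<in> A} = {z. z - x \<in> A \<and> z - y \<in> A}"
    by (auto simp: algebra_simps intro!: rev_image_eqI)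
  then show ?thesis
    using card_image[OF inj_on_add, of x "{a \<in> A. a - (y - x) \<in> A}"]
    by (simp add: common_out_def group_game_def)
qed

lemma out_profile_group_game:
  fixes A :: "'a::ab_group_add set"
  shows "out_profile UNIV \<Gamma>[A] = (\<lambda>d. card {a \<in> A. a - d \<in> A}) ` A"
proof (intro equalityI subsetI)
  fix n assume "n \<in> (\<lambda>d. card {a \<in> A. a - d \<in> A}) ` A"
  then obtain d where "d \<in> A" "n = common_out UNIV \<Gamma>[A] 0 d"
    by (auto simp: common_out_group_game)
  moreover from this have "(0, d) \<in> \<Gamma>[A]" by simp
  ultimately show "n \<in> out_profile UNIV \<Gamma>[A]"
    unfolding out_profile_def by blast
qed (auto simp: out_profile_def common_out_group_game)

lemma digraph_iso_mult_unit:
  fixes A :: "'a::comm_ring_1 set"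
  assumes "a dvd 1"
  shows "digraph_iso UNIV \<Gamma>[A] UNIV \<Gamma>[(*) a ` A] ((*) a)"
proof -
  obtain b where b: "b * a = 1" using assms by (metis dvdE mult.commute)
  have inj: "a * x = a * y \<longleftrightarrow> x = y" for x y
    by (metis b mult.assoc mult_1)
  have "bij ((*) a)"
  proof (rule bijI)
    show "inj ((*) a)" by (simp add: inj_def inj)
    show "surj ((*) a)" by (metis b mult.assoc mult.commute mult_1 surjI)
  qed
  then show ?thesis
    unfolding digraph_iso_def group_game_def
    by (auto simp: image_iff inj simp flip: right_diff_distrib)
qed

lemma unit_multiples_isomorphic:
  assumes "B \<in> unit_multiples A"
  shows "digraph_isomorphic UNIV \<Gamma>[B] UNIV \<Gamma>[A]"
  using assms digraph_iso_mult_unit digraph_isomorphic_sym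
  unfolding unit_multiples_def digraph_isomorphic_def by blast

text \<open>Units are closed under multiplication. Applying this to a unit and to its inverse yields
  equality of the two families.\<close>

lemma unit_multiples_mult_subset:
  fixes A :: "'a::comm_ring_1 set"
  assumes "u dvd 1"
  shows "unit_multiples ((*) u ` A) \<subseteq> unit_multiples A"
proof
  fix X assume "X \<in> unit_multiples ((*) u ` A)"
  then obtain a where "a dvd 1" "X = (*) a ` (*) u ` A"
    unfolding unit_multiples_def by blast
  then have "a * u dvd 1" "X = (*) (a * u) ` A"
    using mult_dvd_mono[of a 1 u 1] assms by (simp_all add: image_image mult.assoc)
  then show "X \<in> unit_multiples A"
    unfolding unit_multiples_def by blast
qed

section \<open>Translations and the stabiliser of 0\<close>

lemma digraph_iso_translation:
  "digraph_iso UNIV \<Gamma>[A] UNIV \<Gamma>[A] (\<lambda>i. i + k)"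
  by (simp add: digraph_iso_def group_game_def bij_plus_right)

lemma Aut_translations:
  assumes "\<And>g. digraph_iso UNIV \<Gamma>[A] UNIV \<Gamma>[A] g \<Longrightarrow> g 0 = 0 \<Longrightarrow> g = id"
  shows "carrier (digraph_Aut UNIV \<Gamma>[A]) = translation_maps"
proof -
  have "f \<in> translation_maps" if f: "digraph_iso UNIV \<Gamma>[A] UNIV \<Gamma>[A] f" for f
  proof -
    \<comment> \<open>Translating back by f 0 gives an automorphism fixing 0, to which the
      assumption applies.\<close>
    have "(\<lambda>i. i + - f 0) \<circ> f = id"
      by (rule assms digraph_iso_comp f digraph_iso_translation)+ simp
    then have "f i = i + f 0" for i
      by (metis comp_apply diff_add_cancel id_apply uminus_add_conv_diff add.commute)
    then show ?thesis unfolding translation_maps_def by blast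
  qed
  then show ?thesis
    unfolding carrier_digraph_Aut_UNIV
    by (auto simp: translation_maps_def digraph_iso_translation)
qed

text \<open>
  Fixing \<open>0\<close> forces an automorphism to map \<open>A\<close> to itself. Once it fixes \<open>A\<close> pointwise, a vertex
  outside \<open>A\<close> is pinned down by its out-neighbours in \<open>A\<close>.
\<close>

lemma stabilizer_trivial:
  fixes A :: "'a::ab_group_add set"
  assumes A: "game_subset A"
    and g: "digraph_iso UNIV \<Gamma>[A] UNIV \<Gamma>[A] g" "g 0 = 0"
    and fix_A: "\<And>x. x \<in> A \<Longrightarrow> g x = x"
    and separated: "\<forall>b\<in>A. \<forall>c\<in>A. (\<forall>a\<in>A. a + b \<in> A \<longleftrightarrow> a + c \<in> A) \<longrightarrow> b = c"
  shows "g = id"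
proof
  have edge: "g y - g x \<in> A \<longleftrightarrow> y - x \<in> A" for x y
    using g(1) by (simp add: digraph_iso_def)
  fix y
  consider "y = 0" | "y \<in> A" | "y \<in> uminus ` A"
    using A unfolding game_subset_def by blast
  then show "g y = id y"
  proof cases
    case 3
    then have "- y \<in> A" by auto
    moreover from this have "- g y \<in> A"
      using edge[of 0 y] g(2) by simp
    \<comment> \<open>Both sides speak of out-neighbours in A: \<open>a + - y\<close> lies in A iff
      y beats a. So y and g y beat the same elements of A.\<close>
    moreover have "a + - g y \<in> A \<longleftrightarrow> a + - y \<in> A" if "a \<in> A" for a
      using fix_A[OF that] edge[of a y] by simp
    ultimately have "- g y = - y"
      using separated by blast
    then show ?thesis by simp
  qed (use g fix_A in auto)
qed

lemma stabilizer_card: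
  assumes "digraph_iso UNIV \<Gamma>[A] UNIV \<Gamma>[A] g" "g 0 = 0"
  shows "card {a \<in> A. a - g x \<in> A} = card {a \<in> A. a - x \<in> A}"
  using common_out_iso[OF assms(1), of 0 x] assms(2) by (simp add: common_out_group_game)

lemma stabilizer_mem:
  assumes "digraph_iso UNIV \<Gamma>[A] UNIV \<Gamma>[A] g" "g 0 = 0" "x \<in> A"
  shows "g x \<in> A"
proof -
  have "(0, x) \<in> \<Gamma>[A]" using assms(3) by simp
  then have "(g 0, g x) \<in> \<Gamma>[A]" using assms(1) unfolding digraph_iso_def by blast
  then show ?thesis using assms(2) by simp
qed

section \<open>Group games as games, and their reducibility\<close>

text \<open>The out-neighbours of i form i + A and the in-neighbours i - A, while the disjoint union
  gives order 2 * card A + 1.\<close>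

lemma game_on_group_game:
  fixes A :: "'a::{ab_group_add,finite} set"
  assumes A: "game_subset A"
  shows "game_on UNIV \<Gamma>[A]"
proof -
  have mem: "x \<in> A \<longleftrightarrow> - x \<notin> A" if "x \<noteq> 0" for x
    using A that unfolding game_subset_iff by blast
  have anti: "y - x \<in> A \<longleftrightarrow> x - y \<notin> A" if "x \<noteq> y" for x y
    using mem[of "y - x"] that by (simp only: minus_diff_eq right_minus_eq) blast
  have zero: "0 \<notin> A" using A by (simp add: game_subset_def)
  have "tournament_on UNIV \<Gamma>[A]"
    unfolding tournament_on_def irrefl_def group_game_iff diff_self UNIV_Times_UNIV
    using anti zero by blast
  moreover have "CARD('a) = 2 * card A + 1"
  proof -
    have "CARD('a) = card (A \<union> uminus ` A \<union> {0})"
      using A by (simp add: game_subset_def)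
    also have "\<dots> = card (A \<union> uminus ` A) + 1"
      using A by (subst card_Un_disjoint) (auto simp: game_subset_def)
    also have "card (A \<union> uminus ` A) = card A + card (uminus ` A)"
      using A by (intro card_Un_disjoint) (auto simp: game_subset_def)
    also have "card (uminus ` A) = card A"
      by (intro card_image inj_onI) simp
    finally show ?thesis by simp
  qed
  moreover have "card {j. j - i \<in> A} = card A" "card {j. i - j \<in> A} = card A" for i
  proof -
    have "bij_betw (\<lambda>a. i + a) A {j. j - i \<in> A}"
      by (rule bij_betw_byWitness[where f' = "\<lambda>j. j - i"]) auto
    then show "card {j. j - i \<in> A} = card A" by (metis bij_betw_same_card)
    have "bij_betw (\<lambda>a. i - a) A {j. i - j \<in> A}"
      by (rule bij_betw_byWitness[where f' = "\<lambda>j. i - j"]) auto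
    then show "card {j. i - j \<in> A} = card A" by (metis bij_betw_same_card)
  qed
  ultimately show ?thesis
    by (simp add: game_on_def)
qed

text \<open>Put d = u - v and x = u - w in the criterion for deleting u and v: w beats u iff x is in
  A, and v beats w iff d - x is in A.\<close>

lemma reducible_group_game_iff:
  fixes A :: "'a::{ab_group_add,finite} set"
  assumes "game_subset A"
  shows "reducible_game UNIV \<Gamma>[A] \<longleftrightarrow>
    (\<exists>d. d \<noteq> 0 \<and> (\<forall>x. x \<noteq> 0 \<longrightarrow> x \<noteq> d \<longrightarrow> (x \<in> A \<longleftrightarrow> d - x \<in> A)))" (is "_ \<longleftrightarrow> (\<exists>d. ?P d)")
proof -
  have "game_on (UNIV - {u, v}) (digraph_restrict \<Gamma>[A] (UNIV - {u, v})) \<longleftrightarrow> ?P (u - v)"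
    if "u \<noteq> v" for u v
  proof -
    have "(\<forall>w\<in>UNIV - {u, v}. u - w \<in> A \<longleftrightarrow> w - v \<in> A) \<longleftrightarrow>
        (\<forall>x. x \<noteq> 0 \<longrightarrow> x \<noteq> u - v \<longrightarrow> (x \<in> A \<longleftrightarrow> u - v - x \<in> A))" (is "?L \<longleftrightarrow> ?R")
    proof
      assume L: ?L
      show ?R
      proof (intro allI impI)
        fix x assume "x \<noteq> 0" "x \<noteq> u - v"
        then have "u - x \<in> UNIV - {u, v}" by auto
        from L[rule_format, OF this] show "x \<in> A \<longleftrightarrow> u - v - x \<in> A"
          by (simp add: algebra_simps)
      qed
    next
      assume R: ?R
      show ?L
      proof
        fix w assume "w \<in> UNIV - {u, v}"
        then have "u - w \<noteq> 0" "u - w \<noteq> u - v" by auto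
        from R[rule_format, OF this] show "u - w \<in> A \<longleftrightarrow> w - v \<in> A"
          by (simp add: algebra_simps)
      qed
    qed
    then show ?thesis
      using game_on_remove_two_iff[OF game_on_group_game[OF assms], of u v] that by simp
  qed
  then have "reducible_game UNIV \<Gamma>[A] \<longleftrightarrow> (\<exists>u v. u \<noteq> v \<and> ?P (u - v))"
    unfolding reducible_game_def by blast
  \<comment> \<open>A given d arises from u = d and v = 0.\<close>
  also have "\<dots> \<longleftrightarrow> (\<exists>d. ?P d)"
    by (metis (no_types, lifting) diff_zero right_minus_eq)
  finally show ?thesis .
qed

subsection \<open>The lexicographic product and the wreath product\<close>

lemma UNIV_3: "(UNIV :: 3 set) = {0, 1, 2}" (is "_ = ?S")
proof -
  have "card ?S = CARD(3)" by simp
  then show ?thesis by (metis card_subset_eq finite subset_UNIV)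
qed

lemma all_3: "(\<forall>x::3. P x) \<longleftrightarrow> P 0 \<and> P 1 \<and> P 2"
proof -
  have "(\<forall>x. P x) \<longleftrightarrow> (\<forall>x\<in>{0, 1, 2}. P x)"
    by (simp flip: UNIV_3)
  then show ?thesis by simp
qed

lemma \<Gamma>3_iff: "(p, q) \<in> \<Gamma>3 \<longleftrightarrow> q = p + 1"
proof -
  have "\<forall>p q :: 3. (p, q) \<in> \<Gamma>3 \<longleftrightarrow> q = p + 1"
    unfolding all_3 \<Gamma>3_def by simp
  then show ?thesis by blast
qed

lemma lex_\<Gamma>3_iff:
  "((p, q), (r, s)) \<in> \<Gamma>3 <*lex*> \<Gamma>3 \<longleftrightarrow> r = p + 1 \<or> r = p \<and> s = q + 1"
  by (auto simp: \<Gamma>3_iff)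

text \<open>
  Along an edge of \<open>\<Gamma>3 <*lex*> \<Gamma>3\<close> the number of common out-neighbours is \<open>3\<close> inside a block and
  \<open>1\<close> between blocks, so automorphisms permute the blocks.
\<close>

lemma common_out_lex_\<Gamma>3:
  assumes "(x, y) \<in> \<Gamma>3 <*lex*> \<Gamma>3"
  shows "common_out UNIV (\<Gamma>3 <*lex*> \<Gamma>3) x y = (if fst x = fst y then 3 else 1)"
proof -
  obtain p q r s where xy: "x = (p, q)" "y = (r, s)" by fastforce
  have cyc: "a + 1 \<noteq> a" "a + 1 + 1 \<noteq> a" "a \<noteq> a + 1 + 1" for a :: 3
    by (simp_all add: add.assoc)
  consider "r = p" "s = q + 1" | "r = p + 1"
    using assms unfolding xy lex_\<Gamma>3_iff by blast
  then show ?thesis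
  proof cases
    case 1
    \<comment> \<open>Two consecutive vertices of a 3-cycle have no common out-neighbour in it, but
      both beat the whole next block.\<close>
    have "{z. (x, z) \<in> \<Gamma>3 <*lex*> \<Gamma>3 \<and> (y, z) \<in> \<Gamma>3 <*lex*> \<Gamma>3} = {p + 1} \<times> UNIV"
      unfolding xy 1 by (auto simp: lex_\<Gamma>3_iff cyc simp del: in_lex_prod)
    then show ?thesis
      by (simp add: common_out_def xy 1 del: in_lex_prod)
  next
    case 2
    \<comment> \<open>x beats all of block p + 1, but inside that block y beats only its own
      successor; no other block is beaten by both.\<close>
    have "{z. (x, z) \<in> \<Gamma>3 <*lex*> \<Gamma>3 \<and> (y, z) \<in> \<Gamma>3 <*lex*> \<Gamma>3} = {(p + 1, s + 1)}"
      unfolding xy 2 by (auto simp: lex_\<Gamma>3_iff cyc simp del: in_lex_prod)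
    then show ?thesis
      by (simp add: common_out_def xy 2 cyc del: in_lex_prod)
  qed
qed

section \<open>The wreath product as the automorphism group\<close>

text \<open>The rotation n is read at the target block p + a. This matches the index shift
  \<open>f (i - a)\<close> in \<open>Z3_wreath_Z3\<close> and makes the action
  multiplicative.\<close>

definition wreath_action :: "3 \<times> (3 \<Rightarrow> 3) \<Rightarrow> 3 \<times> 3 \<Rightarrow> 3 \<times> 3" where
  "wreath_action = (\<lambda>(a, n) (p, q). (p + a, q + n (p + a)))"

lemma digraph_iso_wreath_action:
  "digraph_iso UNIV (\<Gamma>3 <*lex*> \<Gamma>3) UNIV (\<Gamma>3 <*lex*> \<Gamma>3) (wreath_action g)"
proof -
  obtain a n where g: "g = (a, n)" by fastforce
  have "bij (wreath_action g)"
    by (rule o_bij[where g = "\<lambda>(p, q). (p - a, q - n p)"]) (auto simp: wreath_action_def g fun_eq_iff)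
  then show ?thesis
    unfolding digraph_iso_def wreath_action_def g
    by (auto simp: lex_\<Gamma>3_iff algebra_simps simp del: in_lex_prod)
qed

lemma wreath_action_surj:
  assumes f: "digraph_iso UNIV (\<Gamma>3 <*lex*> \<Gamma>3) UNIV (\<Gamma>3 <*lex*> \<Gamma>3) f"
  shows "f \<in> range wreath_action"
proof -
  let ?L = "\<Gamma>3 <*lex*> \<Gamma>3"
  have edge: "(x, y) \<in> ?L \<Longrightarrow> (f x, f y) \<in> ?L" for x y
    using f unfolding digraph_iso_def by blast
  \<comment> \<open>The counts 3 and 1 tell edges inside a block from edges between blocks, and f
    preserves counts.\<close>
  have block: "fst (f x) = fst (f y) \<longleftrightarrow> fst x = fst y" if "(x, y) \<in> ?L" for x y
    using common_out_iso[OF f, of x y] unfolding common_out_lex_\<Gamma>3[OF that] common_out_lex_\<Gamma>3[OF edge[OF that]]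
    by (auto split: if_splits)
  have step: "f (p, q + 1) = (fst (f (p, q)), snd (f (p, q)) + 1)" for p q
  proof -
    have e: "((p, q), (p, q + 1)) \<in> ?L" unfolding lex_\<Gamma>3_iff by simp
    have "fst (f (p, q)) = fst (f (p, q + 1))" using block[OF e] by simp
    moreover have "((fst (f (p, q)), snd (f (p, q))), (fst (f (p, q + 1)), snd (f (p, q + 1)))) \<in> ?L"
      using edge[OF e] by (simp only: prod.collapse)
    ultimately show ?thesis
      unfolding lex_\<Gamma>3_iff by (simp add: prod_eq_iff)
  qed
  have fst_step: "fst (f (p + 1, 0)) = fst (f (p, 0)) + 1" for p
  proof -
    have e: "((p, 0), (p + 1, 0)) \<in> ?L" unfolding lex_\<Gamma>3_iff by simp
    have "fst (f (p, 0)) \<noteq> fst (f (p + 1, 0))" using block[OF e] by simp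
    moreover have "((fst (f (p, 0)), snd (f (p, 0))), (fst (f (p + 1, 0)), snd (f (p + 1, 0)))) \<in> ?L"
      using edge[OF e] by (simp only: prod.collapse)
    ultimately show ?thesis
      unfolding lex_\<Gamma>3_iff by simp
  qed
  define a where "a = fst (f (0, 0))"
  \<comment> \<open>Two successor steps from 0 reach all residues mod 3.\<close>
  have fst_f: "\<forall>p. fst (f (p, 0)) = p + a"
    using fst_step[of 0] fst_step[of 1] unfolding all_3 a_def by simp
  have f_block: "\<forall>q. f (p, q) = (fst (f (p, 0)), q + snd (f (p, 0)))" for p
    using step[of p 0] step[of p 1] unfolding all_3 by simp
  \<comment> \<open>The index is shifted by a because the rotation of block i - a is stored at its
    image, block i.\<close>
  have "f = wreath_action (a, \<lambda>i. snd (f (i - a, 0)))"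
  proof
    fix x :: "3 \<times> 3"
    obtain p q where x: "x = (p, q)" by fastforce
    have "f x = (p + a, q + snd (f (p, 0)))"
      unfolding x using f_block fst_f by metis
    then show "f x = wreath_action (a, \<lambda>i. snd (f (i - a, 0))) x"
      unfolding x wreath_action_def by simp
  qed
  then show ?thesis by (rule range_eqI)
qed

lemma inj_wreath_action: "inj wreath_action"
proof (rule injI)
  fix g h assume eq: "wreath_action g = wreath_action h"
  obtain a n b m where gh: "g = (a, n)" "h = (b, m)" by fastforce
  have pt: "(p + a, q + n (p + a)) = (p + b, q + m (p + b))" for p q
    using fun_cong[OF eq, of "(p, q)"] unfolding wreath_action_def gh by (simp only: prod.case)
  from pt[of 0 0] have "a = b" by simp
  moreover have "n i = m i" for i
    using pt[of "i - a" 0] \<open>a = b\<close> by simp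
  ultimately show "g = h" by (simp add: gh fun_eq_iff)
qed

lemma carrier_wreath: "carrier Z3_wreath_Z3 = UNIV"
  by (simp add: Z3_wreath_Z3_def semidirect_product_def Z3_def product_group_def PiE_UNIV_domain)

lemma wreath_action_mult:
  "wreath_action (g \<otimes>\<^bsub>Z3_wreath_Z3\<^esub> h) = wreath_action g \<circ> wreath_action h"
  by (auto simp: Z3_wreath_Z3_def semidirect_product_def Z3_def product_group_def wreath_action_def
      fun_eq_iff algebra_simps split: prod.splits)

lemma wreath_action_iso:
  "wreath_action \<in> iso Z3_wreath_Z3 (digraph_Aut UNIV (\<Gamma>3 <*lex*> \<Gamma>3))"
proof -
  have "wreath_action \<in> hom Z3_wreath_Z3 (digraph_Aut UNIV (\<Gamma>3 <*lex*> \<Gamma>3))"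
    by (rule homI)
      (simp_all add: carrier_digraph_Aut_UNIV digraph_iso_wreath_action wreath_action_mult mult_digraph_Aut_UNIV)
  moreover have "bij_betw wreath_action UNIV {f. digraph_iso UNIV (\<Gamma>3 <*lex*> \<Gamma>3) UNIV (\<Gamma>3 <*lex*> \<Gamma>3) f}"
    unfolding bij_betw_def using inj_wreath_action wreath_action_surj digraph_iso_wreath_action by blast
  ultimately show ?thesis
    by (simp add: iso_def carrier_wreath carrier_digraph_Aut_UNIV)
qed

text \<open>Needed to reverse the isomorphism in \<open>Aut_wreath\<close>. Associativity is pulled
  back from composition along the injective action.\<close>

lemma group_wreath: "group Z3_wreath_Z3"
proof (rule groupI)
  fix g h k
  have "wreath_action (g \<otimes>\<^bsub>Z3_wreath_Z3\<^esub> h \<otimes>\<^bsub>Z3_wreath_Z3\<^esub> k) =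
      wreath_action (g \<otimes>\<^bsub>Z3_wreath_Z3\<^esub> (h \<otimes>\<^bsub>Z3_wreath_Z3\<^esub> k))"
    by (simp add: wreath_action_mult comp_assoc)
  then show "g \<otimes>\<^bsub>Z3_wreath_Z3\<^esub> h \<otimes>\<^bsub>Z3_wreath_Z3\<^esub> k =
      g \<otimes>\<^bsub>Z3_wreath_Z3\<^esub> (h \<otimes>\<^bsub>Z3_wreath_Z3\<^esub> k)"
    by (rule injD[OF inj_wreath_action])
next
  have one: "\<one>\<^bsub>Z3_wreath_Z3\<^esub> = (0, \<lambda>_. 0)"
    by (simp add: Z3_wreath_Z3_def semidirect_product_def Z3_def product_group_def fun_eq_iff)
  fix g :: "3 \<times> (3 \<Rightarrow> 3)"
  obtain a n where g: "g = (a, n)" by fastforce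
  show "\<one>\<^bsub>Z3_wreath_Z3\<^esub> \<otimes>\<^bsub>Z3_wreath_Z3\<^esub> g = g"
    unfolding one by (simp add: g Z3_wreath_Z3_def semidirect_product_def Z3_def product_group_def fun_eq_iff)
  have "(- a, \<lambda>i. - n (i + a)) \<otimes>\<^bsub>Z3_wreath_Z3\<^esub> g = \<one>\<^bsub>Z3_wreath_Z3\<^esub>"
    unfolding one by (rule ext | simp add: g Z3_wreath_Z3_def semidirect_product_def Z3_def product_group_def)+
  then show "\<exists>h\<in>carrier Z3_wreath_Z3. h \<otimes>\<^bsub>Z3_wreath_Z3\<^esub> g = \<one>\<^bsub>Z3_wreath_Z3\<^esub>"
    unfolding carrier_wreath by blast
qed (simp_all add: carrier_wreath)

lemma Aut_wreath:
  assumes "digraph_isomorphic UNIV E UNIV (\<Gamma>3 <*lex*> \<Gamma>3)"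
  shows "digraph_Aut UNIV E \<cong> Z3_wreath_Z3"
proof -
  obtain f where "digraph_iso UNIV (\<Gamma>3 <*lex*> \<Gamma>3) UNIV E f"
    using digraph_isomorphic_sym[OF assms] unfolding digraph_isomorphic_def by blast
  from iso_set_trans[OF wreath_action_iso digraph_Aut_conjugation[OF this]]
  show ?thesis
    by (intro group.iso_sym[OF group_wreath] is_isoI)
qed

subsection \<open>The integers modulo 9\<close>

lemma UNIV_9: "(UNIV :: 9 set) = {0, 1, 2, 3, 4, 5, 6, 7, 8}" (is "_ = ?S")
proof -
  have "card ?S = CARD(9)" by simp
  then show ?thesis by (metis card_subset_eq finite subset_UNIV)
qed

lemma all_9: "(\<forall>x::9. P x) \<longleftrightarrow> P 0 \<and> P 1 \<and> P 2 \<and> P 3 \<and> P 4 \<and> P 5 \<and> P 6 \<and> P 7 \<and> P 8"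
proof -
  have "(\<forall>x. P x) \<longleftrightarrow> (\<forall>x\<in>{0, 1, 2, 3, 4, 5, 6, 7, 8}. P x)"
    by (simp flip: UNIV_9)
  then show ?thesis by simp
qed

lemma ex_9: "(\<exists>x::9. P x) \<longleftrightarrow> P 0 \<or> P 1 \<or> P 2 \<or> P 3 \<or> P 4 \<or> P 5 \<or> P 6 \<or> P 7 \<or> P 8"
  using all_9[of "\<lambda>x. \<not> P x"] by auto

lemma dvd_1_9: "{a::9. a dvd 1} = {1, 2, 4, 5, 7, 8}"
proof -
  have "x \<in> {a::9. a dvd 1} \<longleftrightarrow> x \<in> {1, 2, 4, 5, 7, 8}" for x
  proof -
    have "\<forall>x::9. (\<exists>k. 1 = x * k) \<longleftrightarrow> x \<in> {1, 2, 4, 5, 7, 8}"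
      unfolding all_9 ex_9 by simp
    then show ?thesis by (simp add: dvd_def)
  qed
  then show ?thesis by blast
qed

lemma unit_multiples_9: "unit_multiples (A :: 9 set) = (\<lambda>a. (*) a ` A) ` {1, 2, 4, 5, 7, 8}"
  unfolding unit_multiples_def by (simp add: setcompr_eq_image dvd_1_9)


section \<open>Enumeration of the game subsets of Z_9\<close>

lemma typeI_eq:
  "typeI = {{1,3,5,7},{1,2,5,6},{1,2,3,4},{5,6,7,8},{3,4,7,8},{2,4,6,8}}"
proof -
  have "typeI = {{1,3,5,7},{2,6,10,14},{4,12,20,28},{5,15,25,35},{7,21,35,49},{8,24,40,56}}"
    unfolding typeI_def unit_multiples_9 by simp
  \<comment> \<open>The products left by the simplifier are reduced modulo 9.\<close>
  moreover have "{2,6,10,14::9} = {1,2,5,6}" "{4,12,20,28::9} = {1,2,3,4}" "{5,15,25,35::9} = {5,6,7,8}"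
    "{7,21,35,49::9} = {3,4,7,8}" "{8,24,40,56::9} = {2,4,6,8}" by auto
  ultimately show ?thesis by (simp only:)
qed

lemma typeII_eq:
  "typeII = {{1,5,6,7},{1,2,3,5},{1,2,4,6},{3,5,7,8},{4,6,7,8},{2,3,4,8}}"
proof -
  have "typeII = {{1,5,6,7},{2,10,12,14},{4,20,24,28},{5,25,30,35},{7,35,42,49},{8,40,48,56}}"
    unfolding typeII_def unit_multiples_9 by simp
  moreover have "{2,10,12,14::9} = {1,2,3,5}" "{4,20,24,28::9} = {1,2,4,6}" "{5,25,30,35::9} = {3,5,7,8}"
    "{7,35,42,49::9} = {4,6,7,8}" "{8,40,48,56::9} = {2,3,4,8}" by auto
  ultimately show ?thesis by (simp only:)
qed

lemma typeIII_eq: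
  "typeIII = {{1,3,4,7},{2,5,6,8},{1,4,6,7},{2,3,5,8}}"
proof -
  have "uminus ` {1,3,4,7::9} = {2,5,6,8}" "uminus ` {1,4,6,7::9} = {2,3,5,8}" by auto
  then show ?thesis unfolding typeIII_def by simp
qed

lemma set_eq_9: "(A :: 9 set) = B \<longleftrightarrow> (\<forall>x\<in>{0, 1, 2, 3, 4, 5, 6, 7, 8}. x \<in> A \<longleftrightarrow> x \<in> B)"
  unfolding UNIV_9[symmetric] by blast

text \<open>One independent choice from each of the pairs {1, 8}, {2, 7}, {3, 6}, {4, 5}.\<close>

lemma game_subset_9:
  "game_subset (A :: 9 set) \<longleftrightarrow>
    0 \<notin> A \<and> (8 \<in> A \<longleftrightarrow> 1 \<notin> A) \<and> (7 \<in> A \<longleftrightarrow> 2 \<notin> A) \<and> (6 \<in> A \<longleftrightarrow> 3 \<notin> A) \<and> (5 \<in> A \<longleftrightarrow> 4 \<notin> A)"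
proof -
  have neg: "- 1 = (8::9)" "- 2 = (7::9)" "- 3 = (6::9)" "- 4 = (5::9)"
    "- 5 = (4::9)" "- 6 = (3::9)" "- 7 = (2::9)" "- 8 = (1::9)" by simp_all
  show ?thesis unfolding game_subset_iff all_9 neg by simp argo
qed

lemma game_subsets_9: "{A :: 9 set. game_subset A} = typeI \<union> typeII \<union> typeIII"
proof -
  have "game_subset A \<longleftrightarrow> A \<in> typeI \<union> typeII \<union> typeIII" for A :: "9 set"
    \<comment> \<open>Everything becomes a propositional statement about which residues lie in
      A.\<close>
    unfolding typeI_eq typeII_eq typeIII_eq Un_iff insert_iff empty_iff set_eq_9 game_subset_9 
    by simp argo
  then show ?thesis by blast
qed

lemma card_types: "card typeI = 6" "card typeII = 6" "card typeIII = 4"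
  unfolding typeI_eq typeII_eq typeIII_eq by (simp_all add: set_eq_9)

lemma disjoint_types: "typeI \<inter> typeII = {}" "typeI \<inter> typeIII = {}" "typeII \<inter> typeIII = {}"
  unfolding typeI_eq typeII_eq typeIII_eq by (simp_all add: set_eq_9)

section \<open>Profiles, automorphisms and reducibility of the representatives\<close>

text \<open>Turns the cardinalities into sums that the simplifier can evaluate on explicit
  sets.\<close>

lemma card_filter_sum: "finite A \<Longrightarrow> card {a \<in> A. P a} = (\<Sum>a\<in>A. if P a then 1 else 0)"
  by (simp add: sum.If_cases Int_def)

lemma out_profiles:
  "out_profile UNIV \<Gamma>[{1,3,5,7 :: 9}] = {0,1,2,3}"
  "out_profile UNIV \<Gamma>[{1,5,6,7 :: 9}] = {1,2}"
  "out_profile UNIV \<Gamma>[{1,3,4,7 :: 9}] = {1,3}"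
  unfolding out_profile_group_game
  by (simp_all only: card_filter_sum finite.intros image_insert image_empty) auto

lemma Aut_typeI:
  assumes "A \<in> {{1,3,5,7}, {1,2,3,4 :: 9}}"
  shows "carrier (digraph_Aut UNIV \<Gamma>[A]) = translation_maps"
proof (rule Aut_translations)
  fix g assume g: "digraph_iso UNIV \<Gamma>[A] UNIV \<Gamma>[A] g" "g 0 = 0"
  \<comment> \<open>The four edges leaving 0 have pairwise different counts, so an automorphism
    fixing 0 fixes their ends.\<close>
  have inj: "inj_on (\<lambda>d. card {a \<in> A. a - d \<in> A}) A"
    using assms
    by (elim insertE emptyE; hypsubst;
        simp only: card_filter_sum finite.intros inj_on_insert image_insert image_empty) simp_all
  show "g = id"
  proof (rule stabilizer_trivial[OF _ g])
    show "game_subset A" using assms by (auto simp: game_subset_9)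
    show "g x = x" if "x \<in> A" for x
      using inj stabilizer_card[OF g] stabilizer_mem[OF g that] that by (simp add: inj_on_def)
    show "\<forall>b\<in>A. \<forall>c\<in>A. (\<forall>a\<in>A. a + b \<in> A \<longleftrightarrow> a + c \<in> A) \<longrightarrow> b = c"
      using assms by (elim insertE emptyE; hypsubst) simp_all
  qed
qed

lemma Aut_typeII:
  "carrier (digraph_Aut UNIV \<Gamma>[{1,5,6,7 :: 9}]) = translation_maps"
proof (rule Aut_translations)
  let ?A = "{1,5,6,7 :: 9}"
  fix g assume g: "digraph_iso UNIV \<Gamma>[?A] UNIV \<Gamma>[?A] g" "g 0 = 0"
  define c where "c d = card {a \<in> ?A. a - d \<in> ?A}" for d
  have c: "c 1 = 2" "c 5 = 2" "c 6 = 1" "c 7 = 1"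
    unfolding c_def by (simp_all only: card_filter_sum finite.intros) simp_all
  have gc: "c (g x) = c x" for x
    unfolding c_def by (rule stabilizer_card[OF g])
  have edge: "g y - g x \<in> ?A \<longleftrightarrow> y - x \<in> ?A" for x y
    using g(1) unfolding digraph_iso_def by (metis UNIV_I group_game_iff)
  have cases: "g 1 = 1 \<or> g 1 = 5" "g 5 = 1 \<or> g 5 = 5" "g 6 = 6 \<or> g 6 = 7" "g 7 = 6 \<or> g 7 = 7"
    using stabilizer_mem[OF g, of 1] stabilizer_mem[OF g, of 5]
      stabilizer_mem[OF g, of 6] stabilizer_mem[OF g, of 7]
      gc[of 1] gc[of 5] gc[of 6] gc[of 7] c by auto
  \<comment> \<open>By the counts, g maps {1, 5} and {6, 7} into themselves. The edges 5 -> 1 and 6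
    -> 7 rule out swaps, whose differences would be 4 and 8, and collapses, whose difference would
    be 0.\<close>
  have "g 1 - g 5 \<in> ?A" "g 7 - g 6 \<in> ?A"
    unfolding edge by simp_all
  with cases have fix_A: "g 1 = 1 \<and> g 5 = 5" "g 6 = 6 \<and> g 7 = 7"
    by (elim disjE; simp)+
  show "g = id"
  proof (rule stabilizer_trivial[OF _ g])
    show "game_subset ?A" by (simp add: game_subset_9)
    show "g x = x" if "x \<in> ?A" for x
      using that fix_A by auto
    show "\<forall>b\<in>?A. \<forall>c\<in>?A. (\<forall>a\<in>?A. a + b \<in> ?A \<longleftrightarrow> a + c \<in> ?A) \<longrightarrow> b = c"
      by simp
  qed
qed

lemma reducible_typeI:
  assumes "A \<in> {{1,3,5,7}, {1,2,3,4 :: 9}}"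
  shows "reducible_game UNIV \<Gamma>[A]"
proof -
  have "game_subset A" using assms by (auto simp: game_subset_9)
  \<comment> \<open>Suitable values are d = 8 for {1, 3, 5, 7} and d = 5 for {1, 2, 3, 4}.\<close>
  moreover have "\<exists>d. d \<noteq> 0 \<and> (\<forall>x. x \<noteq> 0 \<longrightarrow> x \<noteq> d \<longrightarrow> (x \<in> A \<longleftrightarrow> d - x \<in> A))"
    using assms unfolding all_9 ex_9 by (elim insertE emptyE) simp_all
  ultimately show ?thesis by (simp only: reducible_group_game_iff)
qed

lemma not_reducible_typeII: "\<not> reducible_game UNIV \<Gamma>[{1,5,6,7 :: 9}]"
proof -
  have "game_subset {1,5,6,7 :: 9}" by (simp add: game_subset_9)
  moreover have "\<forall>d. d \<noteq> 0 \<longrightarrow> (\<exists>x. x \<noteq> 0 \<and> x \<noteq> d \<and> (x \<in> {1,5,6,7 :: 9} \<longleftrightarrow> d - x \<notin> {1,5,6,7}))"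
    unfolding all_9 ex_9 by simp
  ultimately show ?thesis by (simp only: reducible_group_game_iff) blast
qed

section \<open>Type III and the lexicographic product; the unit orbit of Type I\<close>

definition lift3 :: "3 \<Rightarrow> 9" where
  "lift3 x = (if x = 0 then 0 else if x = 1 then 1 else 2)"

text \<open>The blocks are the cosets of {0, 3, 6}. Both sets contain the whole coset {1, 4, 7}, so
  each block beats the next; the remaining element t directs the 3-cycle inside a block. As
  \<open>lift3\<close> is not additive, this is checked by enumeration.\<close>

lemma lex_\<Gamma>3_iso:
  assumes "(t, A) \<in> {(3, {1,3,4,7}), (6, {1,4,6,7 :: 9})}"
  shows "digraph_iso UNIV (\<Gamma>3 <*lex*> \<Gamma>3) UNIV \<Gamma>[A] (\<lambda>(p, q). lift3 p + t * lift3 q)"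
proof -
  let ?f = "\<lambda>(p, q). lift3 p + t * lift3 q"
  have "\<forall>p q p' q'. (?f (p, q) = ?f (p', q') \<longrightarrow> p = p' \<and> q = q') \<and>
      (((p, q), (p', q')) \<in> \<Gamma>3 <*lex*> \<Gamma>3 \<longleftrightarrow> ?f (p', q') - ?f (p, q) \<in> A)"
    using assms unfolding all_3 lex_\<Gamma>3_iff lift3_def
    by (elim insertE emptyE) simp_all
  then have inj: "inj ?f" and
    edge: "\<And>x y. (x, y) \<in> \<Gamma>3 <*lex*> \<Gamma>3 \<longleftrightarrow> ?f y - ?f x \<in> A"
    by (auto simp: inj_def simp del: in_lex_prod)
  \<comment> \<open>Both sides have nine elements, so injectivity gives surjectivity.\<close>
  have "card (range ?f) = CARD(3 \<times> 3)" using inj by (rule card_image)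
  then have "range ?f = UNIV" by (intro card_subset_eq) simp_all
  with inj edge show ?thesis
    by (auto simp: digraph_iso_def bij_betw_def simp del: in_lex_prod)
qed

text \<open>Multiplication by 4 takes {1, 3, 5, 7} to {1, 2, 3, 4}, and its inverse 7 leads
  back.\<close>

lemma unit_multiples_1234: "unit_multiples {1,2,3,4 :: 9} = typeI"
proof -
  have units: "4 dvd (1 :: 9)" "7 dvd (1 :: 9)" using dvd_1_9 by blast+
  have "(*) 4 ` {1,3,5,7 :: 9} = {4,12,20,28}" "(*) 7 ` {1,2,3,4 :: 9} = {7,14,21,28}"
    by simp_all
  moreover have "{4,12,20,28 :: 9} = {1,2,3,4}" "{7,14,21,28 :: 9} = {1,3,5,7}"
    by auto
  ultimately have "(*) 4 ` {1,3,5,7 :: 9} = {1,2,3,4}" "(*) 7 ` {1,2,3,4 :: 9} = {1,3,5,7}"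
    by (simp_all only:)
  then show ?thesis
    using unit_multiples_mult_subset[OF units(1), of "{1,3,5,7}"]
      unit_multiples_mult_subset[OF units(2), of "{1,2,3,4}"]
    unfolding typeI_def by (simp only: subset_antisym)
qed

lemma typeIII_isomorphic_lex:
  assumes "A \<in> typeIII"
  shows "digraph_isomorphic UNIV \<Gamma>[A] UNIV (\<Gamma>3 <*lex*> \<Gamma>3)"
proof -
  have iso: "digraph_isomorphic UNIV \<Gamma>[B] UNIV (\<Gamma>3 <*lex*> \<Gamma>3)"
    if "(t, B) \<in> {(3, {1,3,4,7}), (6, {1,4,6,7 :: 9})}" for t :: 9 and B
    using lex_\<Gamma>3_iso[OF that] digraph_isomorphic_sym unfolding digraph_isomorphic_def by blast
  have base: "digraph_isomorphic UNIV \<Gamma>[{1,3,4,7 :: 9}] UNIV (\<Gamma>3 <*lex*> \<Gamma>3)"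
    "digraph_isomorphic UNIV \<Gamma>[{1,4,6,7 :: 9}] UNIV (\<Gamma>3 <*lex*> \<Gamma>3)"
    by (rule iso, blast)+
  \<comment> \<open>Negation is multiplication by the unit -1, which reduces the two negated sets to
    the base cases.\<close>
  have "(*) (- 1) = (uminus :: 9 \<Rightarrow> 9)" by (rule ext) (rule mult_minus1)
  then have "digraph_isomorphic UNIV \<Gamma>[B] UNIV \<Gamma>[uminus ` B]" for B :: "9 set"
    using digraph_iso_mult_unit[of "-1" B] unfolding digraph_isomorphic_def by auto
  then have "digraph_isomorphic UNIV \<Gamma>[uminus ` B] UNIV \<Gamma>[B]" for B :: "9 set"
    by (rule digraph_isomorphic_sym)
  then show ?thesis
    using assms base digraph_isomorphic_trans[OF _ base(1)] digraph_isomorphic_trans[OF _ base(2)]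
    unfolding typeIII_def by (metis (no_types) insertE emptyE)
qed

section \<open>The types as isomorphism classes\<close>

text \<open>Two games of Type I or II are compared through the subset generating their unit orbit,
  two of Type III through the lexicographic product.\<close>

lemma types_isomorphic:
  assumes "S \<in> {typeI, typeII, typeIII}" "A \<in> S" "B \<in> S"
  shows "digraph_isomorphic UNIV \<Gamma>[A] UNIV \<Gamma>[B]"
proof -
  have unit_case: "digraph_isomorphic UNIV \<Gamma>[A] UNIV \<Gamma>[B]" if "S = unit_multiples C" for C
    using assms(2,3) digraph_isomorphic_trans[OF _ digraph_isomorphic_sym]
    unfolding that by (blast intro: unit_multiples_isomorphic)
  show ?thesis
    using assms(1)
  proof (elim insertE emptyE)
    assume "S = typeIII"
    with assms(2,3) show ?thesis
      by (intro digraph_isomorphic_trans[OF typeIII_isomorphic_lex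
            digraph_isomorphic_sym[OF typeIII_isomorphic_lex]]) simp_all
  qed (use unit_case typeI_def typeII_def in blast)+
qed

lemma profile_types:
  "A \<in> typeI \<Longrightarrow> out_profile UNIV \<Gamma>[A] = {0,1,2,3}"
  "A \<in> typeII \<Longrightarrow> out_profile UNIV \<Gamma>[A] = {1,2}"
  "A \<in> typeIII \<Longrightarrow> out_profile UNIV \<Gamma>[A] = {1,3}"
proof -
  have reps: "{1,3,5,7} \<in> typeI" "{1,5,6,7} \<in> typeII" "{1,3,4,7} \<in> typeIII"
    unfolding typeI_eq typeII_eq typeIII_eq by simp_all
  show "A \<in> typeI \<Longrightarrow> out_profile UNIV \<Gamma>[A] = {0,1,2,3}"
    using out_profile_isomorphic[OF types_isomorphic[of typeI A "{1,3,5,7}"]] reps out_profiles by simp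
  show "A \<in> typeII \<Longrightarrow> out_profile UNIV \<Gamma>[A] = {1,2}"
    using out_profile_isomorphic[OF types_isomorphic[of typeII A "{1,5,6,7}"]] reps out_profiles by simp
  show "A \<in> typeIII \<Longrightarrow> out_profile UNIV \<Gamma>[A] = {1,3}"
    using out_profile_isomorphic[OF types_isomorphic[of typeIII A "{1,3,4,7}"]] reps out_profiles by simp
qed

lemma types_distinct: "typeI \<noteq> typeII" "typeI \<noteq> typeIII" "typeII \<noteq> typeIII"
  using disjoint_types card_types by auto

lemma isomorphic_iff_same_type:
  assumes "S \<in> {typeI, typeII, typeIII}" "T \<in> {typeI, typeII, typeIII}" "A \<in> S" "B \<in> T"
  shows "digraph_isomorphic UNIV \<Gamma>[A] UNIV \<Gamma>[B] \<longleftrightarrow> S = T"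
proof
  assume "digraph_isomorphic UNIV \<Gamma>[A] UNIV \<Gamma>[B]"
  then have eq: "out_profile UNIV \<Gamma>[A] = out_profile UNIV \<Gamma>[B]" by (rule out_profile_isomorphic)
  \<comment> \<open>The value 0 singles out Type I, and the absence of 2 singles out Type
    III.\<close>
  have "(0 \<in> out_profile UNIV \<Gamma>[C] \<longleftrightarrow> R = typeI) \<and> (2 \<in> out_profile UNIV \<Gamma>[C] \<longleftrightarrow> R \<noteq> typeIII)"
    if "R \<in> {typeI, typeII, typeIII}" "C \<in> R" for R C
    using that(1)
  proof (elim insertE emptyE)
  qed (use that(2) profile_types[of C] types_distinct in simp_all)
  from this[OF assms(1,3)] this[OF assms(2,4)] show "S = T"
    using assms(1,2) unfolding eq by (elim insertE emptyE) (simp_all add: types_distinct types_distinct[symmetric])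
qed (use assms types_isomorphic in blast)

lemma type_eq_isomorphism_class:
  assumes "S \<in> {typeI, typeII, typeIII}" "A \<in> S"
  shows "S = {B. game_subset B \<and> digraph_isomorphic UNIV \<Gamma>[B] UNIV \<Gamma>[A]}"
proof -
  have "B \<in> S \<longleftrightarrow> game_subset B \<and> digraph_isomorphic UNIV \<Gamma>[B] UNIV \<Gamma>[A]" for B
  proof -
    have "game_subset B \<longleftrightarrow> (\<exists>T\<in>{typeI, typeII, typeIII}. B \<in> T)"
      using game_subsets_9 by blast
    then show ?thesis
      using assms isomorphic_iff_same_type by blast
  qed
  then show ?thesis by blast
qed

text \<open>Passing through the lexicographic product gives an isomorphism that fixes 0 and 1 but
  sends 3 to 6, whereas an affine map fixing 0 and 1 is the identity.\<close>

lemma nonaffine_isomorphism: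
  "\<exists>f. digraph_iso UNIV \<Gamma>[{1, 3, 4, 7 :: 9}] UNIV \<Gamma>[{1, 4, 6, 7}] f \<and> \<not> affine_map f"
proof -
  define h :: "9 \<Rightarrow> 3 \<times> 3 \<Rightarrow> 9" where "h t = (\<lambda>(p, q). lift3 p + t * lift3 q)" for t
  let ?f = "h 6 \<circ> inv_into UNIV (h 3)"
  have h3: "digraph_iso UNIV (\<Gamma>3 <*lex*> \<Gamma>3) UNIV \<Gamma>[{1,3,4,7}] (h 3)"
    and h6: "digraph_iso UNIV (\<Gamma>3 <*lex*> \<Gamma>3) UNIV \<Gamma>[{1,4,6,7}] (h 6)"
    unfolding h_def by (rule lex_\<Gamma>3_iso; simp)+
  have "inj (h 3)" using h3 by (simp add: digraph_iso_def bij_is_inj)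
  then have "?f (h 3 x) = h 6 x" for x by simp
  from this[of "(0, 0)"] this[of "(1, 0)"] this[of "(0, 1)"]
  have vals: "?f 0 = 0" "?f 1 = 1" "?f 3 = 6" by (simp_all add: h_def lift3_def)
  have "\<not> affine_map ?f"
  proof
    assume "affine_map ?f"
    then obtain a k where f: "?f = (\<lambda>i. a * i + k)" unfolding affine_map_def by blast
    have "k = 0" using vals(1) unfolding f by simp
    then have "a = 1" using vals(2) unfolding f by simp
    with \<open>k = 0\<close> show False using vals(3) unfolding f by simp
  qed
  with digraph_iso_comp[OF digraph_iso_inv_into[OF h3] h6] show ?thesis by blast
qed

lemma partition_types: "partition_on {A :: 9 set. game_subset A} {typeI, typeII, typeIII}"
proof (rule partition_onI)
  show "\<Union> {typeI, typeII, typeIII} = {A. game_subset A}"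
    unfolding game_subsets_9 by blast
  show "disjnt S T" if "S \<in> {typeI, typeII, typeIII}" "T \<in> {typeI, typeII, typeIII}" "S \<noteq> T" for S T
    using that disjoint_types unfolding disjnt_def by blast
  have "{} \<noteq> typeI" "{} \<noteq> typeII" "{} \<noteq> typeIII"
    unfolding typeI_eq typeII_eq typeIII_eq by blast+
  then show "{} \<notin> {typeI, typeII, typeIII}" by simp
qed

lemma card_game_subsets: "card {A :: 9 set. game_subset A} = 16"
proof -
  have "card {A :: 9 set. game_subset A} = (\<Sum>S\<in>{typeI, typeII, typeIII}. card S)"
    using partition_types
    by (subst card_Union_disjoint[symmetric]) (auto simp: partition_on_def disjoint_def disjnt_def pairwise_def)
  then show ?thesis
    using types_distinct card_types by simp
qed

theorem theorem12p2:
  shows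
    "card {A :: 9 set. game_subset A} = 16 \<and>
     partition_on {A :: 9 set. game_subset A} {typeI, typeII, typeIII} \<and>
     card {typeI, typeII, typeIII} = 3 \<and>
     (\<forall>S \<in> {typeI, typeII, typeIII}. \<forall>T \<in> {typeI, typeII, typeIII}. \<forall>A \<in> S. \<forall>B \<in> T.
        digraph_isomorphic UNIV \<Gamma>[A] UNIV \<Gamma>[B] \<longleftrightarrow> S = T) \<and>
     (\<forall>A \<in> {{1, 3, 5, 7}, {1, 2, 3, 4 :: 9}}.
        reducible_game UNIV \<Gamma>[A] \<and>
        carrier (digraph_Aut UNIV \<Gamma>[A]) = translation_maps \<and>
        typeI = {B. game_subset B \<and> digraph_isomorphic UNIV \<Gamma>[B] UNIV \<Gamma>[A]} \<and>
        typeI = unit_multiples A) \<and>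
     card typeI = 6 \<and>
     (\<forall>A \<in> {{1, 5, 6, 7 :: 9}}.
        \<not> reducible_game UNIV \<Gamma>[A] \<and>
        carrier (digraph_Aut UNIV \<Gamma>[A]) = translation_maps \<and>
        typeII = {B. game_subset B \<and> digraph_isomorphic UNIV \<Gamma>[B] UNIV \<Gamma>[A]} \<and>
        typeII = unit_multiples A) \<and>
     card typeII = 6 \<and>
     (\<exists>f. digraph_iso UNIV \<Gamma>[{1, 3, 4, 7 :: 9}] UNIV \<Gamma>[{1, 4, 6, 7}] f \<and> \<not> affine_map f) \<and>
     (\<forall>A \<in> typeIII.
        digraph_isomorphic UNIV \<Gamma>[A] UNIV (\<Gamma>3 <*lex*> \<Gamma>3) \<and>
        digraph_Aut UNIV \<Gamma>[A] \<cong> Z3_wreath_Z3) \<and>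
     {B :: 9 set. game_subset B \<and> digraph_isomorphic UNIV \<Gamma>[B] UNIV (\<Gamma>3 <*lex*> \<Gamma>3)} =
       {{1, 3, 4, 7}, uminus ` {1, 3, 4, 7}, {1, 4, 6, 7}, uminus ` {1, 4, 6, 7}} \<and>
     card typeIII = 4"
proof (intro conjI)
  let ?T = "{typeI, typeII, typeIII}"
  have reps: "{1,3,5,7} \<in> typeI" "{1,2,3,4} \<in> typeI" "{1,5,6,7} \<in> typeII" "{1,3,4,7} \<in> typeIII"
    unfolding typeI_eq typeII_eq typeIII_eq by simp_all
  show "card ?T = 3"
    using types_distinct by simp
  show "\<forall>S\<in>?T. \<forall>T\<in>?T. \<forall>A\<in>S. \<forall>B\<in>T. digraph_isomorphic UNIV \<Gamma>[A] UNIV \<Gamma>[B] \<longleftrightarrow> S = T"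
    by (intro ballI isomorphic_iff_same_type)
  show "\<forall>A\<in>{{1,3,5,7}, {1,2,3,4 :: 9}}.
      reducible_game UNIV \<Gamma>[A] \<and>
      carrier (digraph_Aut UNIV \<Gamma>[A]) = translation_maps \<and>
      typeI = {B. game_subset B \<and> digraph_isomorphic UNIV \<Gamma>[B] UNIV \<Gamma>[A]} \<and>
      typeI = unit_multiples A"
  proof (intro ballI conjI)
    fix A assume A: "A \<in> {{1,3,5,7}, {1,2,3,4 :: 9}}"
    show "reducible_game UNIV \<Gamma>[A]" by (rule reducible_typeI[OF A])
    show "carrier (digraph_Aut UNIV \<Gamma>[A]) = translation_maps" by (rule Aut_typeI[OF A])
    show "typeI = {B. game_subset B \<and> digraph_isomorphic UNIV \<Gamma>[B] UNIV \<Gamma>[A]}"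
      using A reps by (intro type_eq_isomorphism_class) auto
    show "typeI = unit_multiples A"
      using A typeI_def unit_multiples_1234 by blast
  qed
  show "\<forall>A\<in>{{1,5,6,7 :: 9}}.
      \<not> reducible_game UNIV \<Gamma>[A] \<and>
      carrier (digraph_Aut UNIV \<Gamma>[A]) = translation_maps \<and>
      typeII = {B. game_subset B \<and> digraph_isomorphic UNIV \<Gamma>[B] UNIV \<Gamma>[A]} \<and>
      typeII = unit_multiples A"
    using not_reducible_typeII Aut_typeII type_eq_isomorphism_class[of typeII "{1,5,6,7}"] reps typeII_def
    by blast
  show "\<forall>A\<in>typeIII.
      digraph_isomorphic UNIV \<Gamma>[A] UNIV (\<Gamma>3 <*lex*> \<Gamma>3) \<and>
      digraph_Aut UNIV \<Gamma>[A] \<cong> Z3_wreath_Z3"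
    using typeIII_isomorphic_lex Aut_wreath by blast
  \<comment> \<open>The lexicographic product may be replaced by the Type III game of {1, 3, 4, 7},
    whose isomorphism class is known.\<close>
  have "digraph_isomorphic UNIV \<Gamma>[B] UNIV (\<Gamma>3 <*lex*> \<Gamma>3) \<longleftrightarrow>
      digraph_isomorphic UNIV \<Gamma>[B] UNIV \<Gamma>[{1,3,4,7 :: 9}]" for B :: "9 set"
    using digraph_isomorphic_trans[OF _ typeIII_isomorphic_lex[OF reps(4)]]
      digraph_isomorphic_trans[OF _ digraph_isomorphic_sym[OF typeIII_isomorphic_lex[OF reps(4)]]] by blast
  then have "{B :: 9 set. game_subset B \<and> digraph_isomorphic UNIV \<Gamma>[B] UNIV (\<Gamma>3 <*lex*> \<Gamma>3)} = typeIII"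
    using type_eq_isomorphism_class[of typeIII "{1,3,4,7}"] reps by simp
  then show "{B :: 9 set. game_subset B \<and> digraph_isomorphic UNIV \<Gamma>[B] UNIV (\<Gamma>3 <*lex*> \<Gamma>3)} =
      {{1, 3, 4, 7}, uminus ` {1, 3, 4, 7}, {1, 4, 6, 7}, uminus ` {1, 4, 6, 7}}"
    unfolding typeIII_def .
qed (rule card_game_subsets partition_types card_types nonaffine_isomorphism)+

end
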